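(* For any nonzero commutative ring $R$, the formal power series ring $R[\![X]\!]$ in one variable is strictly Egyptian.
   Context: Rings are commutative with identity. A regular element of a ring is an element that is not a zero-divisor. A ring $S$ is strictly Egyptian if, with $W$ the multiplicative set of all regular elements of $S$, for every nonzero $b\in S$ the element $\frac{b}{1}\in W^{-1}S$ can be written as a finite (possibly empty) sum $\frac{1}{w_1}+\cdots+\frac{1}{w_n}$ of reciprocals of pairwise distinct elements $w_1,\dots,w_n$ of $W$. *)

theory Defs
  imports "HOL-Computational_Algebra.Formal_Power_Series"
begin

text \<open>
  Rings are types of class \<^class>\<open>comm_ring_1\<close>; this class contains \<open>0 \<noteq> 1\<close>, so its
  instances are the \<^emph>\<open>nonzero\<close> commutative rings with identity.
\<close>

definition zero_divisor :: "'a::comm_ring_1 \<Rightarrow> bool" where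
  "zero_divisor x \<longleftrightarrow> (\<exists>y. y \<noteq> 0 \<and> x * y = 0)"

definition regular_elements :: "'a::comm_ring_1 set" where
  "regular_elements = {x. \<not> zero_divisor x}"

lemma mem_regular_elements_iff:
  "x \<in> regular_elements \<longleftrightarrow> (\<forall>y. x * y = 0 \<longleftrightarrow> y = 0)"
  by (auto simp: regular_elements_def zero_divisor_def)

lemma one_regular [simp]: "1 \<in> regular_elements"
  by (simp add: mem_regular_elements_iff)

lemma mult_regular [simp]:
  "v \<in> regular_elements \<Longrightarrow> w \<in> regular_elements \<Longrightarrow> v * w \<in> regular_elements"
  by (simp add: mem_regular_elements_iff mult.assoc)

text \<open>
  The localization of \<open>'a\<close> at its regular elements, \<open>W\<^sup>-\<^sup>1 S\<close>, as a quotient of \<open>S \<times> W\<close>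
  by the usual relation for localizations of rings that may have zero divisors.
\<close>

definition localrel :: "'a::comm_ring_1 \<times> 'a \<Rightarrow> 'a \<times> 'a \<Rightarrow> bool" where
  "localrel x y \<longleftrightarrow> snd x \<in> regular_elements \<and> snd y \<in> regular_elements \<and>
     (\<exists>u\<in>regular_elements. u * (fst x * snd y - fst y * snd x) = 0)"

lemma localrel_iff [simp]:
  "localrel x y \<longleftrightarrow> snd x \<in> regular_elements \<and> snd y \<in> regular_elements \<and>
     fst x * snd y = fst y * snd x"
proof -
  have "(\<exists>u\<in>regular_elements. u * d = 0) \<longleftrightarrow> d = 0" for d :: 'a
  proof
    show "d = 0" if "\<exists>u\<in>regular_elements. u * d = 0"
      using that by (auto simp: mem_regular_elements_iff)
    show "\<exists>u\<in>regular_elements. u * d = 0" if "d = 0"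
      using that by (intro bexI[of _ 1]) simp_all
  qed
  then show ?thesis
    by (simp add: localrel_def)
qed

lemma transp_localrel: "transp localrel"
proof (rule transpI, unfold split_paired_all)
  fix a b a' b' a'' b'' :: 'a
  assume A: "localrel (a, b) (a', b')"
  assume B: "localrel (a', b') (a'', b'')"
  have "b' * (a * b'') = b'' * (a * b')" by (simp add: ac_simps)
  also from A have "a * b' = a' * b" by auto
  also have "b'' * (a' * b) = b * (a' * b'')" by (simp add: ac_simps)
  also from B have "a' * b'' = a'' * b'" by auto
  also have "b * (a'' * b') = b' * (a'' * b)" by (simp add: ac_simps)
  finally have "b' * (a * b'' - a'' * b) = 0" by (simp add: algebra_simps)
  moreover from B have "b' \<in> regular_elements" by auto
  ultimately have "a * b'' - a'' * b = 0" by (simp add: mem_regular_elements_iff del: right_minus_eq)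
  then have "a * b'' = a'' * b" by simp
  with A B show "localrel (a, b) (a'', b'')" by auto
qed

lemma part_equivp_localrel: "part_equivp localrel"
  by (rule part_equivpI[OF exI[of _ "(0, 1)"] _ transp_localrel]) (simp_all add: symp_def)

quotient_type (overloaded) 'a total_fract = "'a::comm_ring_1 \<times> 'a" / partial: localrel
  by (rule part_equivp_localrel)

text \<open>The fraction \<open>a/w\<close>; it is the junk value \<open>0/1\<close> unless \<open>w\<close> is regular.\<close>

lift_definition TFract :: "'a::comm_ring_1 \<Rightarrow> 'a \<Rightarrow> 'a total_fract"
  is "\<lambda>a w. if w \<in> regular_elements then (a, w) else (0, 1)"
  by simp

lemma TFract_cases [cases type: total_fract]:
  obtains (TFract) a w where "q = TFract a w" "w \<in> regular_elements"
  by transfer simp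

lemma TFract_eq_iff:
  assumes "v \<in> regular_elements" "w \<in> regular_elements"
  shows "TFract a v = TFract b w \<longleftrightarrow> a * w = b * v"
  using assms by transfer simp

instantiation total_fract :: (comm_ring_1) comm_ring_1
begin

lift_definition zero_total_fract :: "'a total_fract" is "(0, 1)" by simp

lift_definition one_total_fract :: "'a total_fract" is "(1, 1)" by simp

lift_definition plus_total_fract :: "'a total_fract \<Rightarrow> 'a total_fract \<Rightarrow> 'a total_fract"
  is "\<lambda>q r. (fst q * snd r + fst r * snd q, snd q * snd r)"
proof -
  fix p p' q q' :: "'a \<times> 'a"
  assume p: "localrel p p'" and q: "localrel q q'"
  have "(fst p * snd q + fst q * snd p) * (snd p' * snd q') =
      (fst p * snd p') * (snd q * snd q') + (fst q * snd q') * (snd p * snd p')"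
    by (simp add: algebra_simps)
  also have "\<dots> = (fst p' * snd p) * (snd q * snd q') + (fst q' * snd q) * (snd p * snd p')"
    using p q by simp
  also have "\<dots> = (fst p' * snd q' + fst q' * snd p') * (snd p * snd q)"
    by (simp add: algebra_simps)
  finally show "localrel (fst p * snd q + fst q * snd p, snd p * snd q)
      (fst p' * snd q' + fst q' * snd p', snd p' * snd q')"
    using p q by simp
qed

lift_definition uminus_total_fract :: "'a total_fract \<Rightarrow> 'a total_fract"
  is "\<lambda>x. (- fst x, snd x)"
  by simp

definition minus_total_fract :: "'a total_fract \<Rightarrow> 'a total_fract \<Rightarrow> 'a total_fract" where
  "q - r = q + - (r :: 'a total_fract)"

lift_definition times_total_fract :: "'a total_fract \<Rightarrow> 'a total_fract \<Rightarrow> 'a total_fract"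
  is "\<lambda>q r. (fst q * fst r, snd q * snd r)"
proof -
  fix p p' q q' :: "'a \<times> 'a"
  assume p: "localrel p p'" and q: "localrel q q'"
  have "(fst p * fst q) * (snd p' * snd q') = (fst p * snd p') * (fst q * snd q')"
    by (simp add: algebra_simps)
  also have "\<dots> = (fst p' * snd p) * (fst q' * snd q)"
    using p q by simp
  also have "\<dots> = (fst p' * fst q') * (snd p * snd q)"
    by (simp add: algebra_simps)
  finally show "localrel (fst p * fst q, snd p * snd q) (fst p' * fst q', snd p' * snd q')"
    using p q by simp
qed

lemma zero_TFract: "0 = TFract 0 1"
  by transfer simp

lemma one_TFract: "1 = TFract 1 1"
  by transfer simp

lemma add_TFract:
  "v \<in> regular_elements \<Longrightarrow> w \<in> regular_elements \<Longrightarrow>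
     TFract a v + TFract b w = TFract (a * w + b * v) (v * w)"
  by transfer simp

lemma uminus_TFract: "- TFract a w = TFract (- a) w"
  by transfer simp

lemma mult_TFract:
  "v \<in> regular_elements \<Longrightarrow> w \<in> regular_elements \<Longrightarrow>
     TFract a v * TFract b w = TFract (a * b) (v * w)"
  by transfer simp

instance
proof
  fix q r s :: "'a total_fract"
  note ops = zero_TFract one_TFract add_TFract uminus_TFract mult_TFract TFract_eq_iff
  show "(q * r) * s = q * (r * s)"
    by (cases q, cases r, cases s) (simp add: ops algebra_simps)
  show "q * r = r * q"
    by (cases q, cases r) (simp add: ops algebra_simps)
  show "1 * q = q"
    by (cases q) (simp add: ops)
  show "(q + r) + s = q + (r + s)"
    by (cases q, cases r, cases s) (simp add: ops algebra_simps)
  show "q + r = r + q"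
    by (cases q, cases r) (simp add: ops algebra_simps)
  show "0 + q = q"
    by (cases q) (simp add: ops)
  show "- q + q = 0"
    by (cases q) (simp add: ops)
  show "q - r = q + - r"
    by (rule minus_total_fract_def)
  show "(q + r) * s = q * s + r * s"
    by (cases q, cases r, cases s) (simp add: ops algebra_simps)
  show "(0 :: 'a total_fract) \<noteq> 1"
    by (simp add: ops)
qed

end

text \<open>
  A finite sum of reciprocals of pairwise distinct elements of \<open>W\<close> is a sum over a finite
  subset of \<open>W\<close>.
\<close>

definition strictly_egyptian :: "'a::comm_ring_1 itself \<Rightarrow> bool" where
  "strictly_egyptian _ \<longleftrightarrow>
     (\<forall>b::'a. b \<noteq> 0 \<longrightarrow>
        (\<exists>A. finite A \<and> A \<subseteq> regular_elements \<and> TFract b 1 = (\<Sum>w\<in>A. TFract 1 w)))"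

end

theory Submission
  imports Defs
begin

text \<open>
  Both \<open>X\<close> and the unit \<open>1 + b X\<close> are regular, and
  \<open>b = (1 + b X) / X + 1 / (- X)\<close>. If the two denominators \<open>X / (1 + b X)\<close> and \<open>- X\<close>
  coincided, then \<open>b X = - 2\<close>; comparing constant terms would give \<open>2 = 0\<close>, whence \<open>b X = 0\<close>.
\<close>

text \<open>Multiplication by \<open>fps_X\<close> only shifts the coefficients up by one, so none
  is lost.\<close>

lemma fps_X_regular: "fps_X \<in> (regular_elements :: 'a::comm_ring_1 fps set)"
  unfolding mem_regular_elements_iff
proof
  fix y :: "'a fps"
  have "y = 0" if "fps_X * y = 0"
  proof (rule fps_ext)
    fix n
    have "fps_nth y n = fps_nth (fps_X * y) (Suc n)" by simp
    then show "fps_nth y n = fps_nth 0 n" using that by simp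
  qed
  then show "fps_X * y = 0 \<longleftrightarrow> y = 0" by auto
qed

lemma uminus_regular: "w \<in> regular_elements \<Longrightarrow> - w \<in> regular_elements"
  by (simp add: mem_regular_elements_iff)

lemma unit_regular:
  assumes "u * v = 1"
  shows "v \<in> regular_elements"
proof -
  have "y = 0" if "v * y = 0" for y
  proof -
    have "y = u * (v * y)" by (simp add: assms flip: mult.assoc)
    then show ?thesis using that by simp
  qed
  then show ?thesis by (auto simp: mem_regular_elements_iff)
qed

theorem corollary2p9:
  shows "strictly_egyptian TYPE('a::comm_ring_1 fps)"
  unfolding strictly_egyptian_def
proof (intro allI impI)
  fix b :: "'a fps"
  assume "b \<noteq> 0"
  \<comment> \<open>The seed \<open>1\<close> inverts the constant coefficient \<open>1\<close>, so
    this works over any coefficient ring; \<open>fps_X * v\<close> plays the role of X / (1 + b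
    X).\<close>
  define v where "v = fps_right_inverse (1 + b * fps_X) 1"
  have v: "(1 + b * fps_X) * v = 1"
    unfolding v_def by (rule fps_right_inverse) simp
  have X: "(fps_X :: 'a fps) \<in> regular_elements"
    by (rule fps_X_regular)
  have Xv: "fps_X * v \<in> regular_elements"
    using X unit_regular[OF v] by simp
  have mX: "- (fps_X :: 'a fps) \<in> regular_elements"
    using X by (rule uminus_regular)
  have distinct: "fps_X * v \<noteq> - fps_X"
  proof
    assume "fps_X * v = - fps_X"
    then have "fps_X * (v + 1) = 0" by (simp add: algebra_simps)
    then have "v + 1 = 0" using X by (simp only: mem_regular_elements_iff)
    then have "v = - 1" by (simp add: eq_neg_iff_add_eq_0)
    \<comment> \<open>Substituting \<open>v = - 1\<close> into \<open>v\<close> turns it into - (1 +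
      b X) = 1.\<close>
    with v have bX: "b * fps_X = - 2" by (simp add: algebra_simps eq_neg_iff_add_eq_0)
    then have "fps_nth (b * fps_X) 0 = fps_nth (- 2) 0" by simp
    then have "(2 :: 'a) = 0" by (simp add: fps_numeral_nth)
    then have "(2 :: 'a fps) = 0" by (simp add: numeral_fps_const)
    with bX have "fps_X * b = 0" by (simp add: mult.commute)
    then show False using X \<open>b \<noteq> 0\<close> by (simp only: mem_regular_elements_iff)
  qed
  \<comment> \<open>This is b = 1/(X v) + 1/(- X) with denominators cleared.\<close>
  have "b * ((fps_X * v) * - fps_X) = - fps_X * (((1 + b * fps_X) * v) - v)"
    by (simp add: algebra_simps)
  also have "\<dots> = 1 * - fps_X + 1 * (fps_X * v)"
    unfolding v by (simp add: algebra_simps)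
  finally have "TFract b 1 = TFract 1 (fps_X * v) + TFract 1 (- fps_X)"
    by (simp add: add_TFract TFract_eq_iff Xv mX mult_regular del: mult_minus_right)
  then show "\<exists>A. finite A \<and> A \<subseteq> regular_elements \<and> TFract b 1 = (\<Sum>w\<in>A. TFract 1 w)"
    \<comment> \<open>By \<open>distinct\<close> the set has two elements, so its sum keeps both
      reciprocals.\<close>
    using Xv mX distinct by (intro exI[of _ "{fps_X * v, - fps_X}"]) simp
qed

end
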